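(* Let $d\ge 1$ and let $S$ be an $n$-vertex stacked $(d-1)$-sphere. If $n\ge d+2$, then $S$ is a subcomplex of an $n$-vertex stacked $d$-sphere (so the two complexes have the same vertex set).
   Context: Simplicial complexes are finite and abstract; isomorphic complexes are identified. An $n$-vertex complex is one with exactly $n$ vertices. A complex is pure if all its maximal faces have the same dimension; in a pure $k$-dimensional complex, faces of dimension $k$ are facets and faces of dimension $k-1$ are ridges. For a face $\sigma$, $\overline{\sigma}$ denotes the complex consisting of $\sigma$ and all its faces. A standard $k$-ball is a complex $\overline{\sigma}$ with $\sigma$ a $k$-simplex. A simplicial complex $B$ is a stacked $k$-ball if there is a sequence $B_1,\dots,B_m$ of pure simplicial complexes such that $B_1$ is a standard $k$-ball, $B_m=B$ and, for $2\le i\le m$, $B_i=B_{i-1}\cup\overline{\sigma}_i$ and $B_{i-1}\cap\overline{\sigma}_i=\overline{\tau}_i$, where $\sigma_i$ is a facet of $B_i$ and $\tau_i$ is a ridge of $B_i$ that lies in exactly one facet of $B_{i-1}$. The boundary of a stacked $k$-ball $B$ is the pure $(k-1)$-dimensional complex whose facets are the ridges of $B$ lying in exactly one facet of $B$. A stacked $k$-sphere is a complex isomorphic to the boundary of a stacked $(k+1)$-ball. *)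

theory Defs
  imports Main
begin

text \<open>
  Abstract simplicial complexes are sets of faces that include the empty face, so the complex of
  all faces of a simplex \<open>\<sigma>\<close> is \<open>Pow \<sigma>\<close>, and a face of dimension \<open>k\<close> has \<open>k + 1\<close> elements.
  Finiteness of each face follows from finiteness of the complex and closure under subsets.
\<close>

definition simplicial_complex :: "'a set set \<Rightarrow> bool" where
  "simplicial_complex K \<longleftrightarrow> finite K \<and> {} \<in> K \<and> (\<forall>\<sigma>\<in>K. \<forall>\<rho>. \<rho> \<subseteq> \<sigma> \<longrightarrow> \<rho> \<in> K)"

definition vertices :: "'a set set \<Rightarrow> 'a set" where
  "vertices K = {v. {v} \<in> K}"

definition isomorphic_complexes :: "'a set set \<Rightarrow> 'b set set \<Rightarrow> bool" where
  "isomorphic_complexes K L \<longleftrightarrow> simplicial_complex K \<and> simplicial_complex L \<and>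
     (\<exists>f. bij_betw f (vertices K) (vertices L) \<and> L = (\<lambda>\<sigma>. f ` \<sigma>) ` K)"

definition maximal_face :: "'a set set \<Rightarrow> 'a set \<Rightarrow> bool" where
  "maximal_face K \<sigma> \<longleftrightarrow> \<sigma> \<in> K \<and> (\<forall>\<rho>\<in>K. \<sigma> \<subseteq> \<rho> \<longrightarrow> \<rho> = \<sigma>)"

definition pure_complex :: "nat \<Rightarrow> 'a set set \<Rightarrow> bool" where
  "pure_complex k K \<longleftrightarrow> simplicial_complex K \<and> (\<forall>\<sigma>. maximal_face K \<sigma> \<longrightarrow> card \<sigma> = k + 1)"

text \<open>In the following, \<open>k\<close> is the dimension of the pure complex under consideration.\<close>

definition facets :: "nat \<Rightarrow> 'a set set \<Rightarrow> 'a set set" where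
  "facets k K = {\<sigma> \<in> K. card \<sigma> = k + 1}"

definition ridges :: "nat \<Rightarrow> 'a set set \<Rightarrow> 'a set set" where
  "ridges k K = {\<tau> \<in> K. card \<tau> = k}"

definition in_exactly_one_facet :: "nat \<Rightarrow> 'a set set \<Rightarrow> 'a set \<Rightarrow> bool" where
  "in_exactly_one_facet k K \<tau> \<longleftrightarrow> (\<exists>!\<sigma>. \<sigma> \<in> facets k K \<and> \<tau> \<subseteq> \<sigma>)"

definition standard_ball :: "nat \<Rightarrow> 'a set set \<Rightarrow> bool" where
  "standard_ball k B \<longleftrightarrow> (\<exists>\<sigma>. card \<sigma> = k + 1 \<and> B = Pow \<sigma>)"

definition stacked_ball :: "nat \<Rightarrow> 'a set set \<Rightarrow> bool" where
  "stacked_ball k B \<longleftrightarrow>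
     (\<exists>m\<ge>1. \<exists>Bs :: nat \<Rightarrow> 'a set set.
        (\<forall>i\<in>{1..m}. pure_complex k (Bs i)) \<and>
        standard_ball k (Bs 1) \<and> Bs m = B \<and>
        (\<forall>i\<in>{2..m}. \<exists>\<sigma>\<in>facets k (Bs i). \<exists>\<tau>\<in>ridges k (Bs i).
           Bs i = Bs (i - 1) \<union> Pow \<sigma> \<and>
           Bs (i - 1) \<inter> Pow \<sigma> = Pow \<tau> \<and>
           in_exactly_one_facet k (Bs (i - 1)) \<tau>))"

definition boundary :: "nat \<Rightarrow> 'a set set \<Rightarrow> 'a set set" where
  "boundary k B = (\<Union>\<tau>\<in>{\<tau> \<in> ridges k B. in_exactly_one_facet k B \<tau>}. Pow \<tau>)"

text \<open>
  Up to isomorphism every finite complex has vertices in \<open>nat\<close>, so quantifying over balls on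
  \<open>nat\<close> covers all balls, whatever the vertex type of \<open>S\<close>.
\<close>

definition stacked_sphere :: "nat \<Rightarrow> 'a set set \<Rightarrow> bool" where
  "stacked_sphere k S \<longleftrightarrow>
     (\<exists>B :: nat set set. stacked_ball (k + 1) B \<and> isomorphic_complexes S (boundary (k + 1) B))"

end

theory Submission
  imports Defs
begin

text \<open>
  Write \<open>S\<close> as the boundary of a stacked \<open>d\<close>-ball \<open>B\<close>. Following the stacking of \<open>B\<close>, one builds a
  stacked \<open>(d + 1)\<close>-ball \<open>C\<close> on the same vertices such that all of \<open>B\<close>, not only its boundary, lies
  in the boundary of \<open>C\<close>. The first two simplices of \<open>B\<close> span the first simplex of \<open>C\<close>. When a
  simplex with new vertex \<open>v\<close> is glued to \<open>B\<close> along \<open>\<tau>\<close>, the unique facet \<open>\<sigma>\<close> of \<open>B\<close> containing \<open>\<tau>\<close>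
  is a facet of the boundary of \<open>C\<close>, and since that boundary is a closed pseudomanifold there is a
  second boundary facet \<open>\<omega>\<close> containing \<open>\<tau>\<close>. By uniqueness of \<open>\<sigma>\<close>, the simplex \<open>\<omega>\<close> is not in \<open>B\<close>, so
  gluing the cone over \<open>\<omega>\<close> with apex \<open>v\<close> to \<open>C\<close> keeps \<open>B\<close> in the boundary.
\<close>

section \<open>Stacking by new vertices\<close>

text \<open>Replaces the indexed sequence in \<open>stacked_ball\<close> by rule induction. Gluing a
  simplex along exactly one ridge amounts to coning that ridge from a vertex outside the ball, so
  only \<open>\<tau>\<close> and \<open>v\<close> are recorded; purity is recovered by
  \<open>pure_complex_stacking\<close>.\<close>

inductive stacking :: "nat \<Rightarrow> 'a set set \<Rightarrow> bool" for k where
  simplex: "card \<sigma> = k + 1 \<Longrightarrow> stacking k (Pow \<sigma>)"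
| stack: "\<lbrakk>stacking k B; \<tau> \<in> ridges k B; in_exactly_one_facet k B \<tau>; v \<notin> \<Union>B\<rbrakk>
    \<Longrightarrow> stacking k (B \<union> Pow (insert v \<tau>))"

lemma vertices_eq_Union:
  assumes "simplicial_complex K"
  shows "vertices K = \<Union>K"
proof
  show "vertices K \<subseteq> \<Union>K" by (auto simp: vertices_def)
  show "\<Union>K \<subseteq> vertices K"
  proof
    fix x assume "x \<in> \<Union>K"
    then obtain \<sigma> where "\<sigma> \<in> K" "{x} \<subseteq> \<sigma>" by auto
    then show "x \<in> vertices K"
      using assms unfolding simplicial_complex_def vertices_def by blast
  qed
qed

lemma finite_face:
  assumes "simplicial_complex K" "\<sigma> \<in> K"
  shows "finite \<sigma>"
proof -
  have "Pow \<sigma> \<subseteq> K" using assms unfolding simplicial_complex_def by blast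
  then have "finite (Pow \<sigma>)" using assms finite_subset unfolding simplicial_complex_def by blast
  then show ?thesis by simp
qed

lemma simplicial_complex_Pow: "finite \<sigma> \<Longrightarrow> simplicial_complex (Pow \<sigma>)"
  unfolding simplicial_complex_def by auto

lemma simplicial_complex_Un:
  "\<lbrakk>simplicial_complex K; simplicial_complex L\<rbrakk> \<Longrightarrow> simplicial_complex (K \<union> L)"
  unfolding simplicial_complex_def by auto

lemma simplicial_complex_stacking: "stacking k B \<Longrightarrow> simplicial_complex B"
proof (induction rule: stacking.induct)
  case (simplex \<sigma>)
  then have "finite \<sigma>" using card.infinite by fastforce
  then show ?case by (rule simplicial_complex_Pow)
next
  case (stack B \<tau> v)
  then have "finite \<tau>" by (auto simp: ridges_def intro: finite_face)
  with stack show ?case by (simp add: simplicial_complex_Un simplicial_complex_Pow)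
qed

lemma facets_Pow:
  assumes "card \<sigma> = k + 1"
  shows "facets k (Pow \<sigma>) = {\<sigma>}"
proof -
  have "finite \<sigma>" using assms card.infinite by fastforce
  then have "\<omega> = \<sigma>" if "\<omega> \<subseteq> \<sigma>" "card \<omega> = k + 1" for \<omega>
    using that assms by (intro card_subset_eq) auto
  then show ?thesis using assms by (auto simp: facets_def)
qed

lemma facets_stack:
  assumes "card (insert v \<tau>) = k + 1"
  shows "facets k (B \<union> Pow (insert v \<tau>)) = insert (insert v \<tau>) (facets k B)"
  using facets_Pow[OF assms] by (auto simp: facets_def)

lemma card_insert_ridge:
  assumes "stacking k B" "\<tau> \<in> ridges k B" "v \<notin> \<Union>B"
  shows "finite \<tau>" "v \<notin> \<tau>" "card \<tau> = k" "card (insert v \<tau>) = k + 1"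
proof -
  show "finite \<tau>" "v \<notin> \<tau>" "card \<tau> = k"
    using assms by (auto simp: ridges_def intro: finite_face simplicial_complex_stacking)
  then show "card (insert v \<tau>) = k + 1" by simp
qed

lemma stacking_face_in_facet:
  "\<lbrakk>stacking k B; \<rho> \<in> B\<rbrakk> \<Longrightarrow> \<exists>\<sigma>\<in>facets k B. \<rho> \<subseteq> \<sigma>"
proof (induction arbitrary: \<rho> rule: stacking.induct)
  case (simplex \<sigma>)
  then show ?case by (auto simp: facets_Pow)
next
  case (stack B \<tau> v)
  then show ?case
    using facets_stack[OF card_insert_ridge(4)[OF stack.hyps(1,2,4)]] by auto
qed

lemma pure_complex_stacking:
  assumes "stacking k B"
  shows "pure_complex k B"
  unfolding pure_complex_def
proof (intro conjI allI impI)
  show "simplicial_complex B" using assms by (rule simplicial_complex_stacking)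
  fix \<sigma> assume "maximal_face B \<sigma>"
  then show "card \<sigma> = k + 1"
    using stacking_face_in_facet[OF assms, of \<sigma>] unfolding maximal_face_def facets_def by auto
qed

section \<open>Equivalence with the definition by sequences\<close>

text \<open>The glued simplex \<open>\<sigma>\<close> has a single vertex \<open>v\<close> outside
  \<open>\<tau>\<close>. If \<open>v\<close> were already a vertex, \<open>{v}\<close> would lie in
  the intersection \<open>Pow \<tau>\<close>; hence \<open>v\<close> is new.\<close>

lemma stacked_ball_stacking:
  fixes B :: "'a set set"
  assumes "stacked_ball k B"
  shows "stacking k B"
proof -
  obtain m and Bs :: "nat \<Rightarrow> 'a set set" where m: "m \<ge> 1" and pure: "\<forall>i\<in>{1..m}. pure_complex k (Bs i)"
    and first: "standard_ball k (Bs 1)" and last: "Bs m = B"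
    and glue: "\<forall>i\<in>{2..m}. \<exists>\<sigma>\<in>facets k (Bs i). \<exists>\<tau>\<in>ridges k (Bs i).
           Bs i = Bs (i - 1) \<union> Pow \<sigma> \<and> Bs (i - 1) \<inter> Pow \<sigma> = Pow \<tau> \<and>
           in_exactly_one_facet k (Bs (i - 1)) \<tau>"
    using assms unfolding stacked_ball_def by blast
  have "stacking k (Bs i)" if "1 \<le> i" "i \<le> m" for i
    using that
  proof (induction i rule: dec_induct)
    case base
    obtain \<sigma> where "card \<sigma> = k + 1" "Bs 1 = Pow \<sigma>"
      using first unfolding standard_ball_def by (elim exE conjE)
    then show ?case by (metis stacking.simplex)
  next
    case (step j)
    then have IH: "stacking k (Bs j)" by simp
    have "Suc j \<in> {2..m}" using step.hyps step.prems by auto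
    from bspec[OF glue this, unfolded diff_Suc_1] obtain \<sigma> \<tau>
      where \<sigma>\<tau>: "\<sigma> \<in> facets k (Bs (Suc j))" "\<tau> \<in> ridges k (Bs (Suc j))"
      and eq: "Bs (Suc j) = Bs j \<union> Pow \<sigma>" and int: "Bs j \<inter> Pow \<sigma> = Pow \<tau>"
      and one: "in_exactly_one_facet k (Bs j) \<tau>"
      by (elim bexE conjE) (rule that)
    have \<sigma>: "card \<sigma> = k + 1" and \<tau>: "card \<tau> = k" using \<sigma>\<tau> by (simp_all add: facets_def ridges_def)
    have "finite \<sigma>" using \<sigma> card.infinite by fastforce
    have "\<tau> \<in> Bs j" "\<tau> \<subseteq> \<sigma>" using int by auto
    then have "card (\<sigma> - \<tau>) = 1"
      using \<sigma> \<tau> \<open>finite \<sigma>\<close> by (simp add: card_Diff_subset finite_subset)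
    then obtain v where "\<sigma> - \<tau> = {v}" by (auto simp: card_1_singleton_iff)
    then have v: "\<sigma> = insert v \<tau>" "v \<notin> \<tau>" "v \<in> \<sigma>" using \<open>\<tau> \<subseteq> \<sigma>\<close> by auto
    have "v \<notin> \<Union>(Bs j)"
    proof
      assume "v \<in> \<Union>(Bs j)"
      then have "{v} \<in> Bs j"
        using vertices_eq_Union[OF simplicial_complex_stacking[OF IH]] by (auto simp: vertices_def)
      then show False using int v by blast
    qed
    with IH one \<tau> \<open>\<tau> \<in> Bs j\<close> show ?case
      unfolding eq v(1) by (intro stacking.stack) (auto simp: ridges_def)
  qed
  then show ?thesis using m last by blast
qed

text \<open>Leads from the constructed ball \<open>C\<close> back to the original notion: the
  sequence for \<open>B\<close> is prolonged by one entry.\<close>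

lemma stacking_stacked_ball:
  fixes B :: "'a set set"
  shows "stacking k B \<Longrightarrow> stacked_ball k B"
proof (induction rule: stacking.induct)
  case (simplex \<sigma>)
  then have "pure_complex k (Pow \<sigma>)" by (intro pure_complex_stacking stacking.simplex)
  with simplex show ?case
    unfolding stacked_ball_def standard_ball_def
    by (intro exI[of _ 1] conjI exI[of _ "\<lambda>_. Pow \<sigma>"]) auto
next
  case (stack B \<tau> v)
  let ?B = "B \<union> Pow (insert v \<tau>)"
  obtain m and Bs :: "nat \<Rightarrow> 'a set set" where m: "m \<ge> 1" and pure: "\<forall>i\<in>{1..m}. pure_complex k (Bs i)"
    and base: "standard_ball k (Bs 1)" and last: "Bs m = B"
    and step: "\<forall>i\<in>{2..m}. \<exists>\<sigma>\<in>facets k (Bs i). \<exists>\<tau>\<in>ridges k (Bs i).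
           Bs i = Bs (i - 1) \<union> Pow \<sigma> \<and> Bs (i - 1) \<inter> Pow \<sigma> = Pow \<tau> \<and>
           in_exactly_one_facet k (Bs (i - 1)) \<tau>"
    using stack.IH unfolding stacked_ball_def by blast
  note card = card_insert_ridge[OF stack.hyps(1,2,4)]
  have pure': "pure_complex k ?B"
    using stack.hyps by (intro pure_complex_stacking stacking.stack)
  have "Pow \<tau> \<subseteq> B"
    using stack.hyps simplicial_complex_stacking[of k B]
    unfolding simplicial_complex_def ridges_def by blast
  then have int: "B \<inter> Pow (insert v \<tau>) = Pow \<tau>"
    using stack.hyps(4) by blast
  have new: "\<exists>\<sigma>\<in>facets k ?B. \<exists>\<tau>\<in>ridges k ?B. ?B = B \<union> Pow \<sigma> \<and> B \<inter> Pow \<sigma> = Pow \<tau> \<and>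
      in_exactly_one_facet k B \<tau>"
    using card int stack.hyps
    by (intro bexI[of _ "insert v \<tau>"] bexI[of _ \<tau>]) (auto simp: facets_def ridges_def)
  define Cs where "Cs = Bs(Suc m := ?B)"
  have "\<forall>i\<in>{1..Suc m}. pure_complex k (Cs i)"
    using pure pure' by (auto simp: Cs_def)
  moreover have "standard_ball k (Cs 1)" using base m by (simp add: Cs_def)
  moreover have "Cs (Suc m) = ?B" by (simp add: Cs_def)
  moreover have "\<forall>i\<in>{2..Suc m}. \<exists>\<sigma>\<in>facets k (Cs i). \<exists>\<tau>\<in>ridges k (Cs i).
           Cs i = Cs (i - 1) \<union> Pow \<sigma> \<and> Cs (i - 1) \<inter> Pow \<sigma> = Pow \<tau> \<and>
           in_exactly_one_facet k (Cs (i - 1)) \<tau>" (is "\<forall>i\<in>_. ?P i")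
  proof
    fix i assume i: "i \<in> {2..Suc m}"
    show "?P i"
    proof (cases "i = Suc m")
      case True
      then show ?thesis using new last by (simp add: Cs_def)
    next
      case False
      then have "Cs i = Bs i" "Cs (i - 1) = Bs (i - 1)" "i \<in> {2..m}"
        using i by (auto simp: Cs_def)
      then show ?thesis using step by simp
    qed
  qed
  moreover have "1 \<le> Suc m" by simp
  ultimately show ?case
    unfolding stacked_ball_def by (intro exI[of _ "Suc m"] conjI exI[of _ Cs])
qed

section \<open>Boundary ridges\<close>

text \<open>The facets of \<open>boundary k B\<close>, kept as a family of \<open>k\<close>-element
  sets so that the effect of a gluing can be computed exactly.\<close>

definition boundary_ridges :: "nat \<Rightarrow> 'a set set \<Rightarrow> 'a set set" where
  "boundary_ridges k B = {\<tau> \<in> ridges k B. in_exactly_one_facet k B \<tau>}"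

lemma boundary_eq: "boundary k B = (\<Union>\<tau>\<in>boundary_ridges k B. Pow \<tau>)"
  by (simp add: boundary_def boundary_ridges_def)

lemma Union_boundary: "\<Union>(boundary k B) = \<Union>(boundary_ridges k B)"
  by (auto simp: boundary_eq)

lemma boundary_ridgesD:
  assumes "stacking k B" "\<omega> \<in> boundary_ridges k B"
  shows "\<omega> \<in> B" "card \<omega> = k" "finite \<omega>"
  using assms finite_face[OF simplicial_complex_stacking]
  by (auto simp: boundary_ridges_def ridges_def)

lemma boundary_ridges_Pow:
  assumes "card \<sigma> = k + 1"
  shows "boundary_ridges k (Pow \<sigma>) = {\<omega>. \<omega> \<subseteq> \<sigma> \<and> card \<omega> = k}"
  using facets_Pow[OF assms]
  by (auto simp: boundary_ridges_def ridges_def in_exactly_one_facet_def)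

lemma subset_card_eq_remove:
  assumes "finite \<sigma>" "card \<sigma> = k + 1" "\<omega> \<subseteq> \<sigma>" "card \<omega> = k"
  obtains x where "x \<in> \<sigma>" "\<omega> = \<sigma> - {x}"
proof -
  have "card (\<sigma> - \<omega>) = 1"
    using assms by (simp add: card_Diff_subset finite_subset)
  then obtain x where "\<sigma> - \<omega> = {x}" by (auto simp: card_1_singleton_iff)
  then show thesis using assms(3) by (intro that[of x]) auto
qed

text \<open>Gluing puts \<open>\<rho>\<close> into a second facet, so it leaves the boundary; the
  ridges of the new simplex through \<open>v\<close> lie in no other facet, so they enter it.
  Nothing else changes, since \<open>\<rho>\<close> is the only \<open>k\<close>-element face of the
  new simplex that avoids \<open>v\<close>.\<close>

lemma boundary_ridges_stack:
  assumes B: "stacking k B" and \<rho>: "\<rho> \<in> boundary_ridges k B" and v: "v \<notin> \<Union>B"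
  shows "boundary_ridges k (B \<union> Pow (insert v \<rho>)) =
    (boundary_ridges k B - {\<rho>}) \<union> (\<lambda>x. insert v \<rho> - {x}) ` \<rho>"
proof -
  let ?\<sigma> = "insert v \<rho>" and ?B = "B \<union> Pow (insert v \<rho>)"
  note card = card_insert_ridge[OF B _ v, of \<rho>]
  have r: "\<rho> \<in> ridges k B" "in_exactly_one_facet k B \<rho>" using \<rho> by (auto simp: boundary_ridges_def)
  note facets = facets_stack[OF card(4)[OF r(1)], of B]
  have new: "\<not> \<omega> \<subseteq> \<sigma>" if "v \<in> \<omega>" "\<sigma> \<in> facets k B" for \<omega> \<sigma>
    using that v by (auto simp: facets_def)
  have old: "\<omega> = \<rho>" if "\<omega> \<subseteq> ?\<sigma>" "v \<notin> \<omega>" "card \<omega> = k" for \<omega>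
    using that card[OF r(1)] by (metis card_subset_eq subset_insert)
  have "?\<sigma> \<notin> facets k B" using v by (auto simp: facets_def)
  have one: "in_exactly_one_facet k ?B \<omega> \<longleftrightarrow> (if v \<in> \<omega> then \<omega> \<subseteq> ?\<sigma> else in_exactly_one_facet k B \<omega> \<and> \<omega> \<noteq> \<rho>)"
    if "card \<omega> = k" for \<omega>
  proof (cases "v \<in> \<omega>")
    case True
    then show ?thesis using new[OF True] unfolding in_exactly_one_facet_def facets by auto
  next
    case False
    show ?thesis
    proof (cases "\<omega> = \<rho>")
      case True
      obtain \<sigma> where "\<sigma> \<in> facets k B" "\<rho> \<subseteq> \<sigma>" using r(2) unfolding in_exactly_one_facet_def by blast
      then show ?thesis using True False \<open>?\<sigma> \<notin> facets k B\<close>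
        unfolding in_exactly_one_facet_def facets by auto
    next
      case neq: False
      then have "\<sigma> \<in> facets k ?B \<and> \<omega> \<subseteq> \<sigma> \<longleftrightarrow> \<sigma> \<in> facets k B \<and> \<omega> \<subseteq> \<sigma>" for \<sigma>
        using old[OF _ False that] unfolding facets by blast
      then show ?thesis using False neq unfolding in_exactly_one_facet_def by simp
    qed
  qed
  show ?thesis
  proof (intro equalityI subsetI)
    fix \<omega> assume "\<omega> \<in> boundary_ridges k ?B"
    then have \<omega>: "\<omega> \<in> ?B" "card \<omega> = k" "in_exactly_one_facet k ?B \<omega>"
      by (auto simp: boundary_ridges_def ridges_def)
    show "\<omega> \<in> (boundary_ridges k B - {\<rho>}) \<union> (\<lambda>x. ?\<sigma> - {x}) ` \<rho>"
    proof (cases "v \<in> \<omega>")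
      case True
      then have "\<omega> \<subseteq> ?\<sigma>" using \<omega> one by simp
      then obtain x where "x \<in> ?\<sigma>" "\<omega> = ?\<sigma> - {x}"
        using subset_card_eq_remove[of ?\<sigma> k \<omega>] card[OF r(1)] \<omega> by auto
      with True show ?thesis by auto
    next
      case False
      then have *: "in_exactly_one_facet k B \<omega>" "\<omega> \<noteq> \<rho>" using \<omega> one by simp_all
      then have "\<omega> \<in> B" using \<omega> old[OF _ False] by auto
      with * \<omega> show ?thesis by (simp add: boundary_ridges_def ridges_def)
    qed
  next
    fix \<omega> assume "\<omega> \<in> (boundary_ridges k B - {\<rho>}) \<union> (\<lambda>x. ?\<sigma> - {x}) ` \<rho>"
    then show "\<omega> \<in> boundary_ridges k ?B"
    proof
      assume *: "\<omega> \<in> boundary_ridges k B - {\<rho>}"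
      then have "v \<notin> \<omega>" "card \<omega> = k" using v by (auto simp: boundary_ridges_def ridges_def)
      with * one[of \<omega>] show ?thesis by (auto simp: boundary_ridges_def ridges_def)
    next
      assume "\<omega> \<in> (\<lambda>x. ?\<sigma> - {x}) ` \<rho>"
      then obtain x where x: "x \<in> \<rho>" "\<omega> = ?\<sigma> - {x}" by auto
      then have "v \<in> \<omega>" "card \<omega> = k" "\<omega> \<subseteq> ?\<sigma>" using card[OF r(1)] by auto
      with one[of \<omega>] show ?thesis by (auto simp: boundary_ridges_def ridges_def)
    qed
  qed
qed

text \<open>Merges the two ridge premises of \<open>stack\<close> into membership in
  \<open>boundary_ridges\<close>, the form in which \<open>boundary_ridges_stack\<close>
  applies.\<close>

lemma stacking_induct [consumes 1, case_names simplex stack]: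
  assumes "stacking k B"
    and "\<And>\<sigma>. card \<sigma> = k + 1 \<Longrightarrow> finite \<sigma> \<Longrightarrow> P (Pow \<sigma>)"
    and "\<And>B \<rho> v. \<lbrakk>stacking k B; \<rho> \<in> boundary_ridges k B; v \<notin> \<Union>B; P B\<rbrakk>
      \<Longrightarrow> P (B \<union> Pow (insert v \<rho>))"
  shows "P B"
  using assms(1)
proof (induction rule: stacking.induct)
  case (simplex \<sigma>)
  then have "finite \<sigma>" using card.infinite by fastforce
  with simplex show ?case by (rule assms(2))
next
  case (stack B \<tau> v)
  then show ?case using assms(3) by (simp add: boundary_ridges_def)
qed

text \<open>The existence half of the closed pseudomanifold property, which supplies
  \<open>\<omega>\<close> in the construction of \<open>C\<close>. By induction: a partner destroyed
  by a gluing is replaced by a facet through the new vertex.\<close>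

lemma second_boundary_ridge:
  assumes "stacking k B" "\<omega> \<in> boundary_ridges k B" "x \<in> \<omega>"
  shows "\<exists>\<omega>'\<in>boundary_ridges k B. \<omega>' \<noteq> \<omega> \<and> \<omega> - {x} \<subseteq> \<omega>'"
  using assms
proof (induction arbitrary: \<omega> x rule: stacking_induct)
  case (simplex \<sigma>)
  then have "\<omega> \<subseteq> \<sigma>" by (simp add: boundary_ridges_Pow)
  \<comment> \<open>Omitting \<open>x\<close> yields a facet that contains
    \<open>\<omega> - {x}\<close> and differs from \<open>\<omega>\<close> because
    \<open>x \<in> \<omega>\<close>.\<close>
  with simplex show ?case
    by (intro bexI[of _ "\<sigma> - {x}"]) (auto simp: boundary_ridges_Pow)
next
  case (stack B \<rho> v)
  note bd = boundary_ridges_stack[OF stack.hyps]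
  note card_\<rho> = boundary_ridgesD[OF stack.hyps(1,2)]
  have "v \<notin> \<rho>" using card_\<rho> stack.hyps(3) by auto
  have v_notin: "v \<notin> \<omega>'" if "\<omega>' \<in> boundary_ridges k B" for \<omega>'
    using boundary_ridgesD(1)[OF stack.hyps(1) that] stack.hyps(3) by auto
  have new_bd: "insert v \<rho> - {y} \<in> boundary_ridges k (B \<union> Pow (insert v \<rho>))" if "y \<in> \<rho>" for y
    using that unfolding bd by blast
  from stack.prems(1) consider (old) "\<omega> \<in> boundary_ridges k B" "\<omega> \<noteq> \<rho>"
    | (new) y where "y \<in> \<rho>" "\<omega> = insert v \<rho> - {y}"
    unfolding bd by auto
  then show ?case
  proof cases
    case old
    obtain \<omega>' where \<omega>': "\<omega>' \<in> boundary_ridges k B" "\<omega>' \<noteq> \<omega>" "\<omega> - {x} \<subseteq> \<omega>'"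
      using stack.IH[OF old(1) stack.prems(2)] by blast
    show ?thesis
    proof (cases "\<omega>' = \<rho>")
      case False
      with \<omega>' show ?thesis unfolding bd by auto
    next
      case True
      \<comment> \<open>The old partner \<open>\<rho>\<close> has left the boundary. Counting gives
        \<open>y \<in> \<rho>\<close> outside \<open>\<omega> - {x}\<close>, so the new ridge
        opposite \<open>y\<close> still contains \<open>\<omega> - {x}\<close>, and it is not
        \<open>\<omega>\<close> since it contains \<open>v\<close>.\<close>
      have "card (\<omega> - {x}) < card \<rho>"
        using boundary_ridgesD[OF stack.hyps(1) old(1)] card_\<rho> stack.prems(2)
        by (metis card_Diff1_less)
      then obtain y where y: "y \<in> \<rho>" "y \<notin> \<omega> - {x}"
        using boundary_ridgesD(3)[OF stack.hyps(1) old(1)]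
        by (metis card_mono finite_Diff not_less subsetI)
      have "insert v \<rho> - {y} \<noteq> \<omega>"
        using \<open>v \<notin> \<rho>\<close> y(1) v_notin[OF old(1)] by auto
      moreover have "\<omega> - {x} \<subseteq> insert v \<rho> - {y}" using True \<omega>'(3) y by auto
      ultimately show ?thesis
        using new_bd[OF y(1)] by (intro bexI[of _ "insert v \<rho> - {y}"] conjI)
    qed
  next
    case new
    show ?thesis
    proof (cases "x = v")
      case True
      \<comment> \<open>Here \<open>\<omega> - {v} = \<rho> - {y}\<close>, so the partner of the
        vanished ridge \<open>\<rho>\<close> across \<open>\<rho> - {y}\<close> serves for
        \<open>\<omega>\<close>; being different from \<open>\<rho>\<close>, it survives the
        gluing.\<close>
      obtain \<omega>' where \<omega>': "\<omega>' \<in> boundary_ridges k B" "\<omega>' \<noteq> \<rho>" "\<rho> - {y} \<subseteq> \<omega>'"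
        using stack.IH[OF stack.hyps(2) new(1)] by blast
      moreover have "\<omega>' \<noteq> \<omega>" using v_notin[OF \<omega>'(1)] new \<open>v \<notin> \<rho>\<close> by auto
      moreover have "\<omega>' \<in> boundary_ridges k (B \<union> Pow (insert v \<rho>))"
        using \<omega>'(1,2) unfolding bd by simp
      moreover have "\<omega> - {x} \<subseteq> \<omega>'" using True new \<omega>'(3) by auto
      ultimately show ?thesis by (intro bexI[of _ \<omega>'] conjI)
    next
      case False
      then have "x \<in> \<rho>" using new stack.prems(2) by auto
      then have "insert v \<rho> - {x} \<in> boundary_ridges k (B \<union> Pow (insert v \<rho>))" by (rule new_bd)
      moreover have "insert v \<rho> - {x} \<noteq> \<omega>" using stack.prems(2) by auto
      moreover have "\<omega> - {x} \<subseteq> insert v \<rho> - {x}" using new by auto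
      ultimately show ?thesis by (intro bexI[of _ "insert v \<rho> - {x}"] conjI)
    qed
  qed
qed

section \<open>Vertices of the boundary\<close>

text \<open>For \<open>k = 1\<close> this would fail: a stacked 1-ball is a path, whose inner
  vertices are missing from the boundary. For \<open>k \<ge> 2\<close> the vertices of the ridge
  \<open>\<rho>\<close> lost in a gluing are covered by the new ridges through
  \<open>v\<close>.\<close>

lemma Union_boundary_ridges:
  assumes "stacking k B" "k \<ge> 2"
  shows "\<Union>(boundary_ridges k B) = \<Union>B"
proof
  show "\<Union>(boundary_ridges k B) \<subseteq> \<Union>B" using boundary_ridgesD(1)[OF assms(1)] by blast
  show "\<Union>B \<subseteq> \<Union>(boundary_ridges k B)"
    using assms(1)
  proof (induction rule: stacking_induct)
    case (simplex \<sigma>)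
    show ?case
    proof
      fix u assume "u \<in> \<Union>(Pow \<sigma>)"
      then have "u \<in> \<sigma>" by auto
      then have "card (\<sigma> - {u}) \<noteq> 0" using simplex assms(2) by simp
      then obtain y where "y \<in> \<sigma>" "y \<noteq> u" by (metis Diff_iff card_gt_0_iff equals0I insertI1 neq0_conv)
      then have "\<sigma> - {y} \<in> boundary_ridges k (Pow \<sigma>)" "u \<in> \<sigma> - {y}"
        using simplex \<open>u \<in> \<sigma>\<close> by (auto simp: boundary_ridges_Pow)
      then show "u \<in> \<Union>(boundary_ridges k (Pow \<sigma>))" by blast
    qed
  next
    case (stack B \<rho> v)
    note bd = boundary_ridges_stack[OF stack.hyps]
    note card_\<rho> = boundary_ridgesD[OF stack.hyps(1,2)]
    have new_bd: "insert v \<rho> - {y} \<in> boundary_ridges k (B \<union> Pow (insert v \<rho>))" if "y \<in> \<rho>" for y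
      using that unfolding bd by blast
    have *: "insert v \<rho> \<subseteq> \<Union>(boundary_ridges k (B \<union> Pow (insert v \<rho>)))"
    proof
      fix u assume u: "u \<in> insert v \<rho>"
      \<comment> \<open>With \<open>k \<ge> 2\<close>, \<open>\<rho>\<close> has a vertex
        \<open>y\<close> other than \<open>u\<close>; the new ridge opposite \<open>y\<close>
        contains \<open>u\<close>.\<close>
      have "card (\<rho> - {u}) \<noteq> 0" using card_\<rho> assms(2) by (simp add: card_Diff_singleton_if)
      then obtain y where "y \<in> \<rho>" "y \<noteq> u" by (metis Diff_iff card_gt_0_iff equals0I insertI1 neq0_conv)
      with u have "u \<in> insert v \<rho> - {y}" by simp
      with new_bd[OF \<open>y \<in> \<rho>\<close>] show "u \<in> \<Union>(boundary_ridges k (B \<union> Pow (insert v \<rho>)))" by blast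
    qed
    have "\<Union>B \<subseteq> \<Union>(boundary_ridges k (B \<union> Pow (insert v \<rho>)))"
    proof
      fix u assume "u \<in> \<Union>B"
      then obtain \<omega> where "\<omega> \<in> boundary_ridges k B" "u \<in> \<omega>" using stack.IH by blast
      then show "u \<in> \<Union>(boundary_ridges k (B \<union> Pow (insert v \<rho>)))"
      proof (cases "\<omega> = \<rho>")
        case True
        with * \<open>u \<in> \<omega>\<close> show ?thesis by blast
      next
        case False
        with \<open>\<omega> \<in> boundary_ridges k B\<close> have "\<omega> \<in> boundary_ridges k (B \<union> Pow (insert v \<rho>))"
          unfolding bd by simp
        with \<open>u \<in> \<omega>\<close> show ?thesis by blast
      qed
    qed
    with * show ?case by auto
  qed
qed

text \<open>A stacked 1-ball is a path and its boundary consists of the two ends; each gluing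
  exchanges an end \<open>r\<close> for \<open>v\<close>. The bound excludes \<open>d = 1\<close> in
  the theorem.\<close>

lemma card_boundary_ridges_1:
  assumes "stacking 1 B"
  shows "finite (\<Union>(boundary_ridges 1 B)) \<and> card (\<Union>(boundary_ridges 1 B)) \<le> 2"
  using assms
proof (induction rule: stacking_induct)
  case (simplex \<sigma>)
  have "\<Union>(boundary_ridges 1 (Pow \<sigma>)) \<subseteq> \<sigma>" using simplex by (subst boundary_ridges_Pow) auto
  with simplex show ?case by (metis card_mono finite_subset one_add_one)
next
  case (stack B \<rho> v)
  let ?U = "\<Union>(boundary_ridges 1 B)"
  note bd = boundary_ridges_stack[OF stack.hyps]
  obtain r where r: "\<rho> = {r}"
    using boundary_ridgesD[OF stack.hyps(1,2)] by (auto simp: card_1_singleton_iff)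
  have "\<Union>(boundary_ridges 1 (B \<union> Pow (insert v \<rho>))) \<subseteq> insert v (?U - {r})"
  proof
    fix u assume "u \<in> \<Union>(boundary_ridges 1 (B \<union> Pow (insert v \<rho>)))"
    then obtain \<omega> where \<omega>: "u \<in> \<omega>" "\<omega> \<in> (boundary_ridges 1 B - {\<rho>}) \<union> (\<lambda>x. insert v \<rho> - {x}) ` \<rho>"
      unfolding bd by (elim UnionE)
    from \<omega>(2) show "u \<in> insert v (?U - {r})"
    proof
      assume a: "\<omega> \<in> boundary_ridges 1 B - {\<rho>}"
      then have "\<omega> = {u}"
        using boundary_ridgesD(2)[OF stack.hyps(1), of \<omega>] \<omega>(1) by (auto simp: card_1_singleton_iff)
      with a r show ?thesis by auto
    next
      assume "\<omega> \<in> (\<lambda>x. insert v \<rho> - {x}) ` \<rho>"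
      with \<omega>(1) r show ?thesis by auto
    qed
  qed
  moreover have "finite (insert v (?U - {r}))" using stack.IH by simp
  moreover have "card (insert v (?U - {r})) \<le> 2"
  proof -
    have "r \<in> ?U" using stack.hyps(2) r by blast
    then have "Suc (card (?U - {r})) = card ?U" using stack.IH by (intro card_Suc_Diff1) auto
    moreover have "card (insert v (?U - {r})) \<le> Suc (card (?U - {r}))" 
      using stack.IH by (simp add: card_insert_if del: card_Diff_insert)
    ultimately show ?thesis using stack.IH by linarith
  qed
  ultimately show ?case by (meson card_mono finite_subset le_trans)
qed

section \<open>A ball in the boundary of a ball\<close>

text \<open>The first alternative is the start of the induction: a single \<open>d\<close>-simplex
  has too few vertices to carry a \<open>(d + 1)\<close>-ball. The invariant mentions only facets of
  \<open>B\<close>; \<open>stacking_face_in_facet\<close> then yields all its faces.\<close>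

lemma stacking_in_boundary:
  assumes "stacking d B"
  shows "(\<exists>\<sigma>. card \<sigma> = d + 1 \<and> B = Pow \<sigma>) \<or>
    (\<exists>C. stacking (d + 1) C \<and> facets d B \<subseteq> boundary_ridges (d + 1) C \<and> \<Union>C = \<Union>B)"
  using assms
proof (induction rule: stacking_induct)
  case (simplex \<sigma>)
  then show ?case by blast
next
  case (stack B \<tau> v)
  have "\<tau> \<in> ridges d B" using stack.hyps(2) by (simp add: boundary_ridges_def)
  note card_\<tau> = card_insert_ridge[OF stack.hyps(1) this stack.hyps(3)]
  note facets = facets_stack[OF card_\<tau>(4), of B]
  have "\<tau> \<in> B" using boundary_ridgesD[OF stack.hyps(1,2)] by simp
  from stack.IH show ?case
  proof
    assume "\<exists>\<sigma>. card \<sigma> = d + 1 \<and> B = Pow \<sigma>"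
    then obtain \<sigma> where \<sigma>: "card \<sigma> = d + 1" "B = Pow \<sigma>" by blast
    then have "finite \<sigma>" by (intro card_ge_0_finite) simp
    then have card: "card (insert v \<sigma>) = d + 1 + 1" using \<sigma> stack.hyps(3) by auto
    \<comment> \<open>Both simplices, \<open>\<sigma>\<close> and \<open>insert v \<tau>\<close>,
      are \<open>(d + 1)\<close>-element subsets of the \<open>(d + 1)\<close>-simplex
      \<open>insert v \<sigma>\<close>.\<close>
    have "facets d (B \<union> Pow (insert v \<tau>)) \<subseteq> boundary_ridges (d + 1) (Pow (insert v \<sigma>))"
      using \<open>\<tau> \<in> B\<close> \<sigma> card_\<tau>(4) unfolding facets boundary_ridges_Pow[OF card]
      by (auto simp: facets_Pow)
    moreover have "\<Union>(Pow (insert v \<sigma>)) = \<Union>(B \<union> Pow (insert v \<tau>))" using \<open>\<tau> \<in> B\<close> \<sigma> by auto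
    ultimately show ?thesis using stacking.simplex[OF card] by blast
  next
    assume "\<exists>C. stacking (d + 1) C \<and> facets d B \<subseteq> boundary_ridges (d + 1) C \<and> \<Union>C = \<Union>B"
    then obtain C where C: "stacking (d + 1) C" "facets d B \<subseteq> boundary_ridges (d + 1) C"
      "\<Union>C = \<Union>B" by blast
    obtain \<sigma> where \<sigma>: "\<sigma> \<in> facets d B" "\<tau> \<subseteq> \<sigma>"
      and unique: "\<And>\<sigma>'. \<lbrakk>\<sigma>' \<in> facets d B; \<tau> \<subseteq> \<sigma>'\<rbrakk> \<Longrightarrow> \<sigma>' = \<sigma>"
      using stack.hyps(2) unfolding boundary_ridges_def in_exactly_one_facet_def by blast
    have \<sigma>_bd: "\<sigma> \<in> boundary_ridges (d + 1) C" using C \<sigma> by blast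
    obtain x where x: "x \<in> \<sigma>" "\<tau> = \<sigma> - {x}"
      using subset_card_eq_remove[OF boundary_ridgesD(3,2)[OF C(1) \<sigma>_bd] \<sigma>(2) card_\<tau>(3)] .
    obtain \<omega> where \<omega>: "\<omega> \<in> boundary_ridges (d + 1) C" "\<omega> \<noteq> \<sigma>" "\<tau> \<subseteq> \<omega>"
      using second_boundary_ridge[OF C(1) \<sigma>_bd x(1)] x(2) by blast
    then have "\<omega> \<notin> facets d B" using unique by blast
    note card_\<omega> = boundary_ridgesD[OF C(1) \<omega>(1)]
    obtain y where y: "y \<in> \<omega>" "\<tau> = \<omega> - {y}"
      using subset_card_eq_remove[OF card_\<omega>(3,2) \<omega>(3) card_\<tau>(3)] .
    have v: "v \<notin> \<Union>C" using C(3) stack.hyps(3) by simp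
    then have "v \<noteq> y" using y(1) card_\<omega>(1) by blast
    let ?C = "C \<union> Pow (insert v \<omega>)"
    have "stacking (d + 1) ?C"
      using C(1) \<omega>(1) v by (intro stacking.stack) (auto simp: boundary_ridges_def)
    moreover have "facets d (B \<union> Pow (insert v \<tau>)) \<subseteq> boundary_ridges (d + 1) ?C"
    proof -
      \<comment> \<open>The new facet of \<open>B\<close> is the ridge of the cone
        \<open>insert v \<omega>\<close> opposite \<open>y\<close>, hence one of those that enter
        the boundary of \<open>C\<close>.\<close>
      have "insert v \<tau> = insert v \<omega> - {y}" using y \<open>v \<noteq> y\<close> by auto
      then show ?thesis
        unfolding facets boundary_ridges_stack[OF C(1) \<omega>(1) v]
        using C(2) \<open>\<omega> \<notin> facets d B\<close> y(1) by auto
    qed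
    moreover have "\<Union>?C = \<Union>(B \<union> Pow (insert v \<tau>))"
    proof -
      have "\<omega> \<subseteq> \<Union>B" "\<tau> \<subseteq> \<Union>B" using card_\<omega>(1) C(3) \<open>\<tau> \<in> B\<close> by blast+
      then show ?thesis using C(3) by auto
    qed
    ultimately show ?thesis by blast
  qed
qed

section \<open>Boundary complexes and transport along isomorphisms\<close>

text \<open>Nonemptiness of \<open>boundary_ridges k B\<close> is what puts the empty face into the
  union.\<close>

lemma simplicial_complex_boundary:
  assumes "stacking k B" "boundary_ridges k B \<noteq> {}"
  shows "simplicial_complex (boundary k B)"
proof -
  have "boundary k B \<subseteq> B"
    using boundary_ridgesD(1)[OF assms(1)] simplicial_complex_stacking[OF assms(1)]
    unfolding boundary_eq simplicial_complex_def by blast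
  then have "finite (boundary k B)"
    using simplicial_complex_stacking[OF assms(1)] finite_subset
    unfolding simplicial_complex_def by blast
  then show ?thesis using assms(2) unfolding simplicial_complex_def boundary_eq by blast
qed

text \<open>The witness is the preimage of \<open>L\<close> under the vertex bijection of
  \<open>S\<close> and \<open>K\<close>. Equality of the vertex sets of \<open>K\<close> and
  \<open>L\<close> lets the same bijection serve for \<open>L\<close>.\<close>

lemma extend_isomorphism:
  assumes iso: "isomorphic_complexes S K" and L: "simplicial_complex L" "K \<subseteq> L"
    "vertices L = vertices K"
  shows "\<exists>T. isomorphic_complexes T L \<and> S \<subseteq> T \<and> vertices T = vertices S"
proof -
  obtain f where f: "bij_betw f (vertices S) (vertices K)" and K: "K = (`) f ` S"
    and S: "simplicial_complex S"
    using iso unfolding isomorphic_complexes_def by blast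
  define T where "T = {\<sigma>. \<sigma> \<subseteq> vertices S \<and> f ` \<sigma> \<in> L}"
  have image: "(`) f ` T = L"
  proof (intro equalityI subsetI)
    fix \<rho> assume \<rho>: "\<rho> \<in> L"
    then have "\<rho> \<subseteq> f ` vertices S"
      using f vertices_eq_Union[OF L(1)] L(3) by (auto simp: bij_betw_def)
    then obtain \<sigma> where "\<sigma> \<subseteq> vertices S" "\<rho> = f ` \<sigma>" by (meson subset_imageE)
    with \<rho> show "\<rho> \<in> (`) f ` T" by (auto simp: T_def)
  qed (auto simp: T_def)
  have "inj_on ((`) f) T"
    using f by (auto simp: T_def bij_betw_def inj_on_image_eq_iff intro!: inj_onI)
  then have "finite T" using image L(1) by (metis finite_imageD simplicial_complex_def)
  then have T: "simplicial_complex T"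
    using L(1) unfolding simplicial_complex_def T_def
    by (auto dest: image_mono[of _ _ f])
  have "S \<subseteq> T"
    using K L(2) vertices_eq_Union[OF S] by (auto simp: T_def)
  moreover have "vertices T = vertices S"
    using \<open>S \<subseteq> T\<close> by (auto simp: vertices_def T_def)
  moreover have "isomorphic_complexes T L"
    unfolding isomorphic_complexes_def using T L f image \<open>vertices T = vertices S\<close> by auto
  ultimately show ?thesis by blast
qed

theorem theorem5:
  fixes S :: "'a set set" and d n :: nat
  assumes "d \<ge> 1"
    and "stacked_sphere (d - 1) S"
    and "card (vertices S) = n"
    and "n \<ge> d + 2"
  shows "\<exists>T :: 'a set set. stacked_sphere d T \<and> card (vertices T) = n \<and>
           S \<subseteq> T \<and> vertices T = vertices S"
proof -
  \<comment> \<open>Since \<open>d \<ge> 1\<close>, the ball dimension \<open>d - 1 + 1\<close> is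
    \<open>d\<close>.\<close>
  obtain B :: "nat set set" where "stacked_ball d B" and iso: "isomorphic_complexes S (boundary d B)"
    using assms(1,2) unfolding stacked_sphere_def by auto
  then have B: "stacking d B" by (simp add: stacked_ball_stacking)
  have sc: "simplicial_complex (boundary d B)" using iso by (simp add: isomorphic_complexes_def)
  have vert: "vertices (boundary d B) = \<Union>(boundary_ridges d B)"
    by (simp add: vertices_eq_Union[OF sc] Union_boundary)
  have n: "card (\<Union>(boundary_ridges d B)) = n"
    using iso assms(3) vert by (auto simp: isomorphic_complexes_def dest: bij_betw_same_card)
  \<comment> \<open>For \<open>d = 1\<close> the boundary would have at most 2 vertices, but
    \<open>n \<ge> 3\<close>.\<close>
  have "d \<noteq> 1" using card_boundary_ridges_1[of B] B n assms(4) by auto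
  then have "\<Union>(boundary_ridges d B) = \<Union>B" using Union_boundary_ridges[OF B] assms(1) by simp
  \<comment> \<open>A single simplex has only \<open>d + 1\<close> vertices, fewer than
    \<open>n\<close>.\<close>
  have "\<nexists>\<sigma>. card \<sigma> = d + 1 \<and> B = Pow \<sigma>"
    using n assms(4) \<open>\<Union>(boundary_ridges d B) = \<Union>B\<close> by auto
  then obtain C where C: "stacking (d + 1) C" "facets d B \<subseteq> boundary_ridges (d + 1) C" "\<Union>C = \<Union>B"
    using stacking_in_boundary[OF B] by blast
  have B_sub: "B \<subseteq> boundary (d + 1) C"
    using stacking_face_in_facet[OF B] C(2) unfolding boundary_eq by blast
  \<comment> \<open>The empty face lies in \<open>boundary (d + 1) C\<close>, so the union defining
    it ranges over a nonempty family.\<close>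
  have "{} \<in> B" using simplicial_complex_stacking[OF B] by (simp add: simplicial_complex_def)
  then have sc_C: "simplicial_complex (boundary (d + 1) C)"
    using B_sub C(1) by (intro simplicial_complex_boundary) (auto simp: boundary_eq)
  have "boundary d B \<subseteq> B"
    using boundary_ridgesD(1)[OF B] simplicial_complex_stacking[OF B]
    unfolding boundary_eq simplicial_complex_def by blast
  \<comment> \<open>Vertices are squeezed: those of the boundary of \<open>C\<close> lie in
    \<open>\<Union>C = \<Union>B\<close>, and \<open>B\<close> lies in that boundary.\<close>
  moreover have "vertices (boundary (d + 1) C) = vertices (boundary d B)"
  proof -
    have "\<Union>(boundary (d + 1) C) \<subseteq> \<Union>C"
      unfolding Union_boundary using boundary_ridgesD(1)[OF C(1)] by blast
    then show ?thesis
      unfolding vert vertices_eq_Union[OF sc_C]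
      using B_sub C(3) \<open>\<Union>(boundary_ridges d B) = \<Union>B\<close> by blast
  qed
  ultimately obtain T where "isomorphic_complexes T (boundary (d + 1) C)" "S \<subseteq> T"
    "vertices T = vertices S"
    using extend_isomorphism[OF iso sc_C] B_sub by blast
  moreover have "stacked_sphere d T"
    unfolding stacked_sphere_def using stacking_stacked_ball[OF C(1)] \<open>isomorphic_complexes T _\<close>
    by (intro exI[of _ C] conjI)
  ultimately show ?thesis using assms(3) by (intro exI[of _ T]) simp
qed

end
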